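(* Every non-empty connected flag exchange complex is contractible. That is: let $X$ be a non-empty connected flag simplicial complex, let $W$ be a well-ordered set, and let $c\colon X^{(0)}\to W$ be a map such that $(X,c)$ is an exchange complex. Then $X$ is contractible.
   Context: A simplicial complex is flag if every finite clique of its $1$-skeleton spans a simplex. $X^{(0)}$ is the vertex set and $\mathrm{dist}$ is the edge-path metric on $X^{(0)}$. For vertices $u,w$ with $\mathrm{dist}(u,w)=2$, let $I(u,w)$ be the set of common neighbours of $u$ and $w$ (the two-interval). A vertex $x\in I(u,w)$ is an apex of $I(u,w)$ if $x$ is equal or adjacent to every member of $I(u,w)$ (equivalently, the full subcomplex on $I(u,w)$ is a cone with apex $x$). For a connected flag simplicial complex $X$, a well-ordered set $W$ (every non-empty subset has a least element) and a map $c\colon X^{(0)}\to W$, the pair $(X,c)$ is an exchange complex if (N1) every two-interval has an apex; and (N2) whenever $\mathrm{dist}(u,w)=2$, some apex $x$ of $I(u,w)$ satisfies $c(x)<\max\{c(u),c(w)\}$. No local finiteness, countability, or injectivity of $c$ is assumed. Contractibility refers to the geometric realisation with the weak (CW) topology. *)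

theory Defs
  imports "HOL-Analysis.Analysis"
begin

text \<open>
  An abstract simplicial complex is represented by its set of (non-empty, finite) simplices.
  Its vertices are the elements of its simplices; they need not exhaust the type.
\<close>

definition abstract_complex :: "'v set set \<Rightarrow> bool" where
  "abstract_complex X \<longleftrightarrow>
     (\<forall>\<sigma>\<in>X. finite \<sigma> \<and> \<sigma> \<noteq> {}) \<and>
     (\<forall>\<sigma>\<in>X. \<forall>\<tau>. \<tau> \<subseteq> \<sigma> \<and> \<tau> \<noteq> {} \<longrightarrow> \<tau> \<in> X)"

definition vertices :: "'v set set \<Rightarrow> 'v set" where
  "vertices X = \<Union>X"

definition adjacent :: "'v set set \<Rightarrow> 'v \<Rightarrow> 'v \<Rightarrow> bool" where
  "adjacent X u w \<longleftrightarrow> u \<noteq> w \<and> {u, w} \<in> X"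

definition clique :: "'v set set \<Rightarrow> 'v set \<Rightarrow> bool" where
  "clique X S \<longleftrightarrow> S \<subseteq> vertices X \<and> (\<forall>u\<in>S. \<forall>w\<in>S. u \<noteq> w \<longrightarrow> adjacent X u w)"

definition flag_complex :: "'v set set \<Rightarrow> bool" where
  "flag_complex X \<longleftrightarrow>
     abstract_complex X \<and> (\<forall>S. finite S \<and> S \<noteq> {} \<and> clique X S \<longrightarrow> S \<in> X)"

definition connected_complex :: "'v set set \<Rightarrow> bool" where
  "connected_complex X \<longleftrightarrow> (\<forall>u\<in>vertices X. \<forall>w\<in>vertices X. \<exists>n. (adjacent X ^^ n) u w)"

text \<open>
  The relation \<open>adjacent X ^^ n\<close> holds between the endpoints of edge paths of length \<open>n\<close>. The
  distance is only meaningful for vertices joined by some edge path, hence for any two vertices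
  of a connected complex.
\<close>

definition edge_dist :: "'v set set \<Rightarrow> 'v \<Rightarrow> 'v \<Rightarrow> nat" where
  "edge_dist X u w = (LEAST n. (adjacent X ^^ n) u w)"

definition two_interval :: "'v set set \<Rightarrow> 'v \<Rightarrow> 'v \<Rightarrow> 'v set" where
  "two_interval X u w = {x \<in> vertices X. adjacent X u x \<and> adjacent X w x}"

definition is_apex :: "'v set set \<Rightarrow> 'v set \<Rightarrow> 'v \<Rightarrow> bool" where
  "is_apex X I x \<longleftrightarrow> x \<in> I \<and> (\<forall>y\<in>I. x = y \<or> adjacent X x y)"

definition exchange_complex :: "'v set set \<Rightarrow> ('v \<Rightarrow> 'w::wellorder) \<Rightarrow> bool" where
  "exchange_complex X c \<longleftrightarrow>
     flag_complex X \<and> connected_complex X \<and>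
     (\<forall>u\<in>vertices X. \<forall>w\<in>vertices X. edge_dist X u w = 2 \<longrightarrow>
        (\<exists>x. is_apex X (two_interval X u w) x)) \<and>
     (\<forall>u\<in>vertices X. \<forall>w\<in>vertices X. edge_dist X u w = 2 \<longrightarrow>
        (\<exists>x. is_apex X (two_interval X u w) x \<and> c x < max (c u) (c w)))"

text \<open>
  Points of the geometric realisation are given by their barycentric coordinates. On the closed
  cell of a finite simplex \<open>\<sigma>\<close> all coordinates outside \<open>\<sigma>\<close> vanish, so the topology induced by
  pointwise convergence on \<open>'v \<Rightarrow> real\<close> is the Euclidean one. On an infinite complex the
  realisation does \<^emph>\<open>not\<close> carry the induced topology, but the weak one: a set is open if
  and only if its intersection with every closed cell is relatively open in that cell.
\<close>

definition closed_cell :: "'v set \<Rightarrow> ('v \<Rightarrow> real) set" where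
  "closed_cell \<sigma> = {a. (\<forall>v. 0 \<le> a v) \<and> (\<forall>v. v \<notin> \<sigma> \<longrightarrow> a v = 0) \<and> (\<Sum>v\<in>\<sigma>. a v) = 1}"

definition realisation_points :: "'v set set \<Rightarrow> ('v \<Rightarrow> real) set" where
  "realisation_points X = (\<Union>\<sigma>\<in>X. closed_cell \<sigma>)"

definition realisation_open :: "'v set set \<Rightarrow> ('v \<Rightarrow> real) set \<Rightarrow> bool" where
  "realisation_open X U \<longleftrightarrow>
     U \<subseteq> realisation_points X \<and>
     (\<forall>\<sigma>\<in>X. openin (top_of_set (closed_cell \<sigma>)) (U \<inter> closed_cell \<sigma>))"

definition realisation :: "'v set set \<Rightarrow> ('v \<Rightarrow> real) topology" where
  "realisation X = topology (realisation_open X)"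

lemma istopology_realisation_open: "istopology (realisation_open X)"
  unfolding istopology_def
proof (intro conjI allI impI)
  fix S T assume S: "realisation_open X S" and T: "realisation_open X T"
  have "(S \<inter> T) \<inter> closed_cell \<sigma> = (S \<inter> closed_cell \<sigma>) \<inter> (T \<inter> closed_cell \<sigma>)" for \<sigma>
    by blast
  with S T show "realisation_open X (S \<inter> T)"
    unfolding realisation_open_def by (metis openin_Int le_infI1)
next
  fix \<U> assume *: "\<forall>K\<in>\<U>. realisation_open X K"
  have "openin (top_of_set (closed_cell \<sigma>)) (\<Union>\<U> \<inter> closed_cell \<sigma>)" if "\<sigma> \<in> X" for \<sigma>
  proof -
    have "\<Union>\<U> \<inter> closed_cell \<sigma> = \<Union>((\<lambda>U. U \<inter> closed_cell \<sigma>) ` \<U>)"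
      by blast
    moreover have "openin (top_of_set (closed_cell \<sigma>)) (\<Union>((\<lambda>U. U \<inter> closed_cell \<sigma>) ` \<U>))"
      using * that by (intro openin_Union) (auto simp only: realisation_open_def)
    ultimately show ?thesis
      by (simp only:)
  qed
  with * show "realisation_open X (\<Union>\<U>)"
    unfolding realisation_open_def by blast
qed

lemma openin_realisation: "openin (realisation X) = realisation_open X"
  unfolding realisation_def by (rule topology_inverse'[OF istopology_realisation_open])

lemma topspace_realisation: "topspace (realisation X) = realisation_points X"
proof -
  have "realisation_points X \<inter> closed_cell \<sigma> = closed_cell \<sigma>" if "\<sigma> \<in> X" for \<sigma>
    using that unfolding realisation_points_def by blast
  then have "realisation_open X (realisation_points X)"
    unfolding realisation_open_def by simp
  then show ?thesis
    unfolding topspace_def openin_realisation by (auto simp: realisation_open_def)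
qed

end

theory Submission
  imports Defs
begin

text \<open>
  The vertices are added one at a time in increasing order, after refining the colouring \<open>c\<close> to a
  well-order \<open>R\<close> of the vertices (\<open>wellorder_refinement\<close>). Adding \<open>v\<close> attaches a cone over its
  descending link, the part of its link spanned by smaller vertices. If \<open>v\<close> is not the least vertex,
  this link is again a non-empty exchange complex. It inherits the exchange condition because two of
  its vertices that are not adjacent have the common neighbour \<open>v\<close>, so that their small apex is
  adjacent to \<open>v\<close> and smaller than \<open>v\<close> (\<open>exchange_order_descending_link\<close>). It is non-empty because
  the same exchange removes the greatest vertex from any path whose endpoints lie lower, so that
  \<open>v\<close> can be reached from a smaller vertex without exceeding \<open>v\<close> (\<open>lower_neighbour\<close>). By well-founded
  induction on \<open>v\<close>, over all exchange complexes simultaneously, all descending links are contractible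
  (\<open>contractible_descending_link\<close>).

  It remains to see that a complex whose descending links are non-empty and contractible is itself
  contractible (\<open>contractible_of_contractible_links\<close>). Attaching a cone over a contractible link does
  not change the homotopy type, but the vertices may be added over a transfinite number of steps, so
  the individual deformations have to be combined into a single homotopy. This is done by an explicit
  motion (\<open>slide\<close>). A point with greatest vertex \<open>v\<close> has a height \<open>s\<close> in the cone at \<open>v\<close>, its
  coordinate at \<open>v\<close>, and a base point \<open>y\<close> in the link. Within the time \<open>s / 2\<close> it is moved down to the
  link, with the help of the contraction of the link, and then it continues with the motion of the
  point it has reached, whose greatest vertex is smaller. As the time spent in the cone vanishes with
  the height, the motion on the cone restricts to the one already defined on the link. Every point makes only finitely many descents, since \<open>R\<close> is well-founded, and
  ends at the least vertex at time \<open>1\<close>. Continuity in the weak topology reduces to single cells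
  (\<open>continuous_map_prod_realisation\<close>), where it follows by induction on the greatest vertex.
\<close>

section \<open>Homotopies and the weak topology\<close>

abbreviation unit_interval :: "real topology" where
  "unit_interval \<equiv> top_of_set {0..1}"

lemma abstract_complex_finite: "abstract_complex X \<Longrightarrow> \<sigma> \<in> X \<Longrightarrow> finite \<sigma>"
  by (simp add: abstract_complex_def)

lemma abstract_complex_face:
  "abstract_complex X \<Longrightarrow> \<sigma> \<in> X \<Longrightarrow> \<tau> \<subseteq> \<sigma> \<Longrightarrow> \<tau> \<noteq> {} \<Longrightarrow> \<tau> \<in> X"
  unfolding abstract_complex_def by blast

lemma Hausdorff_space_cell:
  fixes \<sigma> :: "'v set"
  shows "Hausdorff_space (top_of_set (closed_cell \<sigma>))"
proof -
  have "Hausdorff_space (product_topology (\<lambda>i::'v. euclideanreal) UNIV)"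
    by (simp add: Hausdorff_space_product_topology)
  then show ?thesis
    unfolding euclidean_product_topology by (rule Hausdorff_space_subtopology)
qed

lemma compact_closed_cell:
  fixes \<sigma> :: "'v set"
  shows "compact (closed_cell \<sigma>)"
proof -
  let ?B = "\<lambda>v. if v \<in> \<sigma> then {0..1::real} else {0}"
  let ?S = "{a. (\<Sum>v\<in>\<sigma>. a v) = (1::real)}"
  have "compactin (product_topology (\<lambda>i::'v. euclideanreal) UNIV) (PiE UNIV ?B)"
    by (simp add: compactin_PiE)
  then have K: "compact (PiE UNIV ?B)"
    by (simp add: euclidean_product_topology)
  have "continuous_on UNIV (\<lambda>a::'v \<Rightarrow> real. \<Sum>v\<in>\<sigma>. a v)"
    by (intro continuous_intros) simp
  then have S: "closed ?S"
    by (intro closed_Collect_eq) auto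
  have "closed_cell \<sigma> = PiE UNIV ?B \<inter> ?S"
  proof (intro set_eqI iffI)
    fix a assume a: "a \<in> closed_cell \<sigma>"
    have fin: "finite \<sigma>"
      using a by (force simp: closed_cell_def intro: ccontr)
    have "a v \<le> 1" if "v \<in> \<sigma>" for v
      using a member_le_sum [OF that, of a] fin by (auto simp: closed_cell_def)
    then show "a \<in> PiE UNIV ?B \<inter> ?S"
      using a by (auto simp: closed_cell_def)
  next
    fix a assume a: "a \<in> PiE UNIV ?B \<inter> ?S"
    then have "a v \<in> ?B v" for v
      by (blast intro: PiE_mem[OF IntD1 UNIV_I])
    then have "0 \<le> a v \<and> (v \<notin> \<sigma> \<longrightarrow> a v = 0)" for v
      by (metis atLeastAtMost_iff order_refl singletonD)
    moreover have "sum a \<sigma> = 1"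
      using IntD2[OF a] by simp
    ultimately show "a \<in> closed_cell \<sigma>"
      unfolding closed_cell_def by simp
  qed
  then show ?thesis
    using compact_Int_closed[OF K S] by simp
qed

lemma closed_cell_subset_realisation: "\<sigma> \<in> X \<Longrightarrow> closed_cell \<sigma> \<subseteq> realisation_points X"
  by (auto simp: realisation_points_def)

lemma continuous_map_cell_inclusion:
  assumes "\<sigma> \<in> X"
  shows "continuous_map (top_of_set (closed_cell \<sigma>)) (realisation X) (\<lambda>p. p)"
  unfolding continuous_map_def
proof (intro conjI allI impI)
  show "(\<lambda>p. p) \<in> topspace (top_of_set (closed_cell \<sigma>)) \<rightarrow> topspace (realisation X)"
    using assms by (auto simp: topspace_realisation realisation_points_def)
  fix U assume "openin (realisation X) U"
  then have "openin (top_of_set (closed_cell \<sigma>)) (U \<inter> closed_cell \<sigma>)"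
    using assms by (simp add: openin_realisation realisation_open_def)
  then show "openin (top_of_set (closed_cell \<sigma>)) {x \<in> topspace (top_of_set (closed_cell \<sigma>)). x \<in> U}"
    by (simp add: Int_def conj_commute)
qed

text \<open>
  Homotopies may be checked cell by cell. This is not immediate, since a product with a weak
  topology need not be weak; local compactness of the parameter space saves it. Around a point
  \<open>(t, p)\<close> with value in an open \<open>U\<close>, a compact neighbourhood \<open>K\<close> of \<open>t\<close> stays in \<open>U\<close> along \<open>p\<close>, and
  the points along which all of \<open>K\<close> stays in \<open>U\<close> meet every cell in an open set, because the
  projection along a compact factor is closed.
\<close>

lemma continuous_map_prod_realisation:
  assumes J: "locally_compact_space J" "Hausdorff_space J"
    and cells: "\<And>\<sigma>. \<sigma> \<in> X \<Longrightarrow> continuous_map (prod_topology J (top_of_set (closed_cell \<sigma>))) Z f"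
  shows "continuous_map (prod_topology J (realisation X)) Z f"
  unfolding continuous_map_def
proof (intro conjI allI impI)
  show "f \<in> topspace (prod_topology J (realisation X)) \<rightarrow> topspace Z"
  proof
    fix z assume "z \<in> topspace (prod_topology J (realisation X))"
    then obtain \<sigma> where "\<sigma> \<in> X" "z \<in> topspace (prod_topology J (top_of_set (closed_cell \<sigma>)))"
      by (auto simp: topspace_realisation realisation_points_def)
    then show "f z \<in> topspace Z"
      using continuous_map_funspace[OF cells] by blast
  qed
next
  fix U assume U: "openin Z U"
  let ?W = "{z \<in> topspace (prod_topology J (realisation X)). f z \<in> U}"
  have open_cell: "openin (prod_topology J (top_of_set (closed_cell \<sigma>)))
       {z \<in> topspace J \<times> closed_cell \<sigma>. f z \<in> U}" if "\<sigma> \<in> X" for \<sigma>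
    using openin_continuous_map_preimage[OF cells[OF that] U] by simp
  show "openin (prod_topology J (realisation X)) ?W"
    unfolding openin_prod_topology_alt
  proof (intro allI impI)
    fix t p assume "(t, p) \<in> ?W"
    then have t: "t \<in> topspace J" and p: "p \<in> realisation_points X" and fU: "f (t, p) \<in> U"
      by (auto simp: topspace_realisation)
    then obtain \<rho> where \<rho>: "\<rho> \<in> X" "p \<in> closed_cell \<rho>"
      by (auto simp: realisation_points_def)
    have "\<exists>N M. openin J N \<and> openin (top_of_set (closed_cell \<rho>)) M \<and>
        t \<in> N \<and> p \<in> M \<and> N \<times> M \<subseteq> {z \<in> topspace J \<times> closed_cell \<rho>. f z \<in> U}"
      using open_cell[OF \<rho>(1)] t \<rho>(2) fU unfolding openin_prod_topology_alt by blast
    then obtain N where N: "openin J N" "t \<in> N" "\<And>s. s \<in> N \<Longrightarrow> f (s, p) \<in> U"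
      by blast
    obtain K V where K: "compactin J K" "openin J V" "t \<in> V" "V \<subseteq> K" "K \<subseteq> N"
      using J N(1,2) by (metis locally_compact_space_neighbourhood_base neighbourhood_base_of)
    define Q where "Q = {q \<in> realisation_points X. \<forall>s\<in>K. f (s, q) \<in> U}"
    have "openin (top_of_set (closed_cell \<sigma>)) (Q \<inter> closed_cell \<sigma>)" if \<sigma>: "\<sigma> \<in> X" for \<sigma>
    proof -
      let ?C = "top_of_set (closed_cell \<sigma>)"
      let ?JK = "subtopology J K"
      have KJ: "K \<subseteq> topspace J"
        using K(1) compactin_subset_topspace by blast
      then have tJK: "topspace ?JK = K"
        by auto
      have "continuous_map (prod_topology ?JK ?C) Z f"
        using cells[OF \<sigma>] by (simp add: continuous_map_from_subtopology prod_topology_subtopology(1))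
      then have "openin (prod_topology ?JK ?C) {z \<in> K \<times> closed_cell \<sigma>. f z \<in> U}"
        using openin_continuous_map_preimage[OF _ U] tJK by fastforce
      then have "closedin (prod_topology ?JK ?C)
          (topspace (prod_topology ?JK ?C) - {z \<in> K \<times> closed_cell \<sigma>. f z \<in> U})"
        by blast
      moreover have "closed_map (prod_topology ?JK ?C) ?C snd"
        by (intro Abstract_Topological_Spaces.closed_map_snd compact_space_subtopology K(1))
      ultimately have "closedin ?C (snd `
          (topspace (prod_topology ?JK ?C) - {z \<in> K \<times> closed_cell \<sigma>. f z \<in> U}))"
        unfolding closed_map_def by blast
      then have "openin ?C (closed_cell \<sigma> - snd `
          (topspace (prod_topology ?JK ?C) - {z \<in> K \<times> closed_cell \<sigma>. f z \<in> U}))"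
        using openin_diff[OF openin_topspace] by fastforce
      moreover have "closed_cell \<sigma> - snd `
          (topspace (prod_topology ?JK ?C) - {z \<in> K \<times> closed_cell \<sigma>. f z \<in> U}) = Q \<inter> closed_cell \<sigma>" (is "_ - snd ` ?D = _")
      proof (intro set_eqI iffI)
        fix q assume q: "q \<in> closed_cell \<sigma> - snd ` ?D"
        have "f (s, q) \<in> U" if "s \<in> K" for s
        proof (rule ccontr)
          assume "f (s, q) \<notin> U"
          then have "(s, q) \<in> ?D"
            using that q tJK by simp
          then show False
            using q by force
        qed
        then show "q \<in> Q \<inter> closed_cell \<sigma>"
          using q closed_cell_subset_realisation[OF \<sigma>] by (auto simp: Q_def)
      next
        fix q assume "q \<in> Q \<inter> closed_cell \<sigma>"
        then show "q \<in> closed_cell \<sigma> - snd ` ?D"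
          using tJK by (auto simp: Q_def)
      qed
      ultimately show ?thesis
        by simp
    qed
    then have "openin (realisation X) Q"
      by (auto simp: openin_realisation realisation_open_def Q_def)
    moreover have "p \<in> Q"
      using p K(5) N(3) by (auto simp: Q_def)
    moreover have "V \<times> Q \<subseteq> ?W"
      using K(2,4) openin_subset by (fastforce simp: Q_def topspace_realisation)
    ultimately show "\<exists>V Q. openin J V \<and> openin (realisation X) Q \<and> t \<in> V \<and> p \<in> Q \<and> V \<times> Q \<subseteq> ?W"
      using K by blast
  qed
qed

corollary continuous_map_cylinder_realisation:
  assumes "\<And>\<sigma>. \<sigma> \<in> X \<Longrightarrow>
    continuous_map (prod_topology unit_interval (top_of_set (closed_cell \<sigma>))) Z f"
  shows "continuous_map (prod_topology unit_interval (realisation X)) Z f"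
  using assms
  by (intro continuous_map_prod_realisation)
    (auto simp: compact_imp_locally_compact_space compact_space_subtopology Hausdorff_space_subtopology)

section \<open>Cones over closed cells\<close>

text \<open>
  The point \<open>(1 - s) y + s v\<close> of the cone with tip \<open>v\<close>. The height \<open>s\<close> is its \<open>v\<close>-coordinate as soon as
  \<open>y v = 0\<close>; at height \<open>1\<close> the base point \<open>y\<close> is forgotten.
\<close>

definition join_point :: "'v \<Rightarrow> real \<Rightarrow> ('v \<Rightarrow> real) \<Rightarrow> 'v \<Rightarrow> real" where
  "join_point v s y = (\<lambda>w. (1 - s) * y w + (if w = v then s else 0))"

lemma join_point_0 [simp]: "join_point v 0 y = y"
  by (auto simp: join_point_def)

lemma join_point_1: "join_point v 1 y = join_point v 1 z"
  by (auto simp: join_point_def)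

lemma join_point_in_cell:
  assumes "y \<in> closed_cell \<tau>" "v \<notin> \<tau>" "finite \<tau>" "0 \<le> s" "s \<le> 1"
  shows "join_point v s y \<in> closed_cell (insert v \<tau>)"
proof -
  have "(\<Sum>w\<in>\<tau>. (1 - s) * y w + (if w = v then s else 0)) = (\<Sum>w\<in>\<tau>. (1 - s) * y w)"
    using assms(2) by (intro sum.cong) auto
  then show ?thesis
    using assms by (auto simp: closed_cell_def join_point_def simp flip: sum_distrib_left)
qed

lemma join_point_surj:
  assumes p: "p \<in> closed_cell (insert v \<tau>)" and \<tau>: "v \<notin> \<tau>" "finite \<tau>" "\<tau> \<noteq> {}"
  shows "\<exists>s\<in>{0..1}. \<exists>y\<in>closed_cell \<tau>. p = join_point v s y"
proof -
  have p0: "0 \<le> p w" for w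
    using p by (simp add: closed_cell_def)
  have pout: "p w = 0" if "w \<noteq> v" "w \<notin> \<tau>" for w
    using p that by (simp add: closed_cell_def)
  have psum: "p v + (\<Sum>w\<in>\<tau>. p w) = 1"
    using p \<tau> by (simp add: closed_cell_def)
  have nn: "0 \<le> (\<Sum>w\<in>\<tau>. p w)"
    using p0 by (simp add: sum_nonneg)
  then have s: "p v \<in> {0..1}"
    using psum p0[of v] by auto
  show ?thesis
  proof (cases "p v = 1")
    case True
    obtain u where u: "u \<in> \<tau>"
      using \<tau> by blast
    define y where "y w = (if w = u then 1 else 0::real)" for w
    have "y \<in> closed_cell \<tau>"
      using u \<tau> by (auto simp: closed_cell_def y_def)
    moreover have "p w = 0" if "w \<noteq> v" for w
      using pout[OF that] psum True \<tau> p0 by (metis add_cancel_right_right sum_nonneg_eq_0_iff)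
    then have "p = join_point v 1 y"
      using True by (auto simp: join_point_def)
    ultimately show ?thesis
      by force
  next
    case False
    define y where "y w = (if w = v then 0 else p w / (1 - p v))" for w
    have "(\<Sum>w\<in>\<tau>. y w) = (\<Sum>w\<in>\<tau>. p w / (1 - p v))"
      using \<tau> by (intro sum.cong) (auto simp: y_def)
    also have "\<dots> = 1"
      using psum False by (simp flip: sum_divide_distrib)
    finally have "y \<in> closed_cell \<tau>"
      using p0 pout s by (auto simp: closed_cell_def y_def)
    moreover have "p = join_point v (p v) y"
      using False by (auto simp: join_point_def y_def)
    ultimately show ?thesis
      using s by blast
  qed
qed

lemma continuous_on_join_point:
  "continuous_on ({0..1} \<times> S) (\<lambda>(s, y). join_point v s y)"
proof (rule continuous_on_coordinatewise_then_product)
  fix w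
  have "continuous_on UNIV (\<lambda>y::'a \<Rightarrow> real. y w)"
    by simp
  then have "continuous_on ({0..1} \<times> S) (\<lambda>x::real \<times> ('a \<Rightarrow> real). snd x w)"
    by (rule continuous_on_compose2[OF _ continuous_on_snd[OF continuous_on_id]]) auto
  then have "continuous_on ({0..1} \<times> S) (\<lambda>x. (1 - fst x) * snd x w + (if w = v then fst x else 0))"
    by (cases "w = v") (auto intro!: continuous_intros)
  then show "continuous_on ({0..1} \<times> S) (\<lambda>x. (case x of (s, y) \<Rightarrow> join_point v s y) w)"
    by (simp add: join_point_def case_prod_unfold)
qed

lemma continuous_map_join_cell:
  assumes "v \<notin> \<tau>" "finite \<tau>"
  shows "continuous_map (prod_topology unit_interval (top_of_set (closed_cell \<tau>)))
           (top_of_set (closed_cell (insert v \<tau>))) (\<lambda>(s, y). join_point v s y)"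
proof -
  have "prod_topology unit_interval (top_of_set (closed_cell \<tau>)) = top_of_set ({0..1} \<times> closed_cell \<tau>)"
    by (metis prod_topology_subtopology_eu)
  then show ?thesis
    using continuous_on_join_point[of "closed_cell \<tau>" v] join_point_in_cell[OF _ assms]
    by (auto simp: continuous_map_in_subtopology)
qed

lemma continuous_map_join:
  assumes "\<And>\<tau>. \<tau> \<in> L \<Longrightarrow> v \<notin> \<tau> \<and> finite \<tau> \<and> insert v \<tau> \<in> X"
  shows "continuous_map (prod_topology unit_interval (realisation L)) (realisation X)
           (\<lambda>(s, y). join_point v s y)"
proof (rule continuous_map_cylinder_realisation)
  fix \<tau> assume "\<tau> \<in> L"
  then show "continuous_map (prod_topology unit_interval (top_of_set (closed_cell \<tau>)))
          (realisation X) (\<lambda>(s, y). join_point v s y)"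
    using continuous_map_compose[OF continuous_map_join_cell continuous_map_cell_inclusion, of v \<tau> X] assms
    by (auto simp: o_def)
qed

text \<open>
  The coordinates \<open>(s, y)\<close> of a cone degenerate at its tip, so a map out of the cone is awkward to
  handle there directly. Instead, the cone is a quotient of \<open>[0,1] \<times> \<tau>\<close>, and by compactness this
  persists after taking the product with another interval: a homotopy of the cone is continuous if
  it is continuous as a function of \<open>t\<close>, \<open>s\<close> and \<open>y\<close>.
\<close>

lemma quotient_map_join_cell:
  assumes "v \<notin> \<tau>" "finite \<tau>" "\<tau> \<noteq> {}"
  shows "quotient_map
    (prod_topology unit_interval (prod_topology unit_interval (top_of_set (closed_cell \<tau>))))
    (prod_topology unit_interval (top_of_set (closed_cell (insert v \<tau>))))
    (\<lambda>(t, z). (t, case z of (s, y) \<Rightarrow> join_point v s y))"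
proof (rule T1_Spaces.continuous_imp_quotient_map)
  show "continuous_map (prod_topology unit_interval (prod_topology unit_interval (top_of_set (closed_cell \<tau>))))
    (prod_topology unit_interval (top_of_set (closed_cell (insert v \<tau>))))
    (\<lambda>(t, z). (t, case z of (s, y) \<Rightarrow> join_point v s y))"
    unfolding continuous_map_prod_top using continuous_map_join_cell[OF assms(1,2)] by auto
  show "compact_space (prod_topology unit_interval (prod_topology unit_interval (top_of_set (closed_cell \<tau>))))"
    by (simp add: compact_space_subtopology compact_Times compact_closed_cell)
  show "Hausdorff_space (prod_topology unit_interval (top_of_set (closed_cell (insert v \<tau>))))"
    unfolding Hausdorff_space_prod_topology
    by (intro disjI2 conjI Hausdorff_space_cell Hausdorff_space_subtopology Hausdorff_space_euclidean)
  have "(\<lambda>(s, y). join_point v s y) ` ({0..1} \<times> closed_cell \<tau>) = closed_cell (insert v \<tau>)"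
    using join_point_surj[OF _ assms] join_point_in_cell[OF _ assms(1,2)] by force
  then show "(\<lambda>(t, z). (t, case z of (s, y) \<Rightarrow> join_point v s y)) `
    topspace (prod_topology unit_interval (prod_topology unit_interval (top_of_set (closed_cell \<tau>)))) =
    topspace (prod_topology unit_interval (top_of_set (closed_cell (insert v \<tau>))))"
    by (force simp: image_iff set_eq_iff)
qed

section \<open>Sliding a complex down its descending links\<close>

lemma closed_cell_mono:
  assumes "\<sigma> \<subseteq> \<tau>" "finite \<tau>"
  shows "closed_cell \<sigma> \<subseteq> closed_cell \<tau>"
proof
  fix p assume p: "p \<in> closed_cell \<sigma>"
  then have "sum p \<sigma> = sum p \<tau>"
    using assms by (intro sum.mono_neutral_left) (auto simp: closed_cell_def)
  then show "p \<in> closed_cell \<tau>"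
    using p assms by (auto simp: closed_cell_def)
qed

definition strict_well_order :: "('v \<times> 'v) set \<Rightarrow> bool" where
  "strict_well_order R \<longleftrightarrow> wf R \<and> trans R \<and> total R"

lemma strict_well_order_asym:
  "strict_well_order R \<Longrightarrow> (u, v) \<in> R \<Longrightarrow> (v, u) \<notin> R"
  by (meson strict_well_order_def wf_not_sym)

lemma strict_well_order_cases:
  assumes "strict_well_order R"
  obtains "u = v" | "(u, v) \<in> R" | "(v, u) \<in> R"
  using assms unfolding strict_well_order_def total_on_def by blast

lemma finite_has_greatest:
  assumes R: "strict_well_order R" and "finite S" "S \<noteq> {}"
  shows "\<exists>v\<in>S. \<forall>w\<in>S. w = v \<or> (w, v) \<in> R"
  using assms(2,3)
proof (induction S rule: finite_ne_induct)
  case (insert x F)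
  then obtain v where v: "v \<in> F" "\<forall>w\<in>F. w = v \<or> (w, v) \<in> R"
    by blast
  show ?case
  proof (rule strict_well_order_cases[OF R, of x v])
    assume "(v, x) \<in> R"
    then have "\<forall>w\<in>insert x F. w = x \<or> (w, x) \<in> R"
      using v R by (metis insert_iff strict_well_order_def transD)
    then show ?thesis
      by blast
  qed (use v in auto)
qed simp

text \<open>
  The part of the link of \<open>v\<close> that is already present when the vertices are added in increasing
  order and \<open>v\<close> is the next one: adding \<open>v\<close> attaches the cone over this complex.
\<close>

definition descending_link :: "('v \<times> 'v) set \<Rightarrow> 'v set set \<Rightarrow> 'v \<Rightarrow> 'v set set" where
  "descending_link R X v = {\<tau>. \<tau> \<noteq> {} \<and> insert v \<tau> \<in> X \<and> (\<forall>w\<in>\<tau>. (w, v) \<in> R)}"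

text \<open>
  The least vertex \<open>m\<close> is where everything ends up. For any other vertex \<open>v\<close>, the map \<open>h v\<close> is a
  homotopy from the identity of the descending link to some constant map.
\<close>

locale contracted_links =
  fixes R :: "('v \<times> 'v) set" and X :: "'v set set" and m :: 'v
    and h :: "'v \<Rightarrow> real \<times> ('v \<Rightarrow> real) \<Rightarrow> 'v \<Rightarrow> real"
  assumes order: "strict_well_order R"
    and complex: "abstract_complex X"
    and least: "v \<in> vertices X \<Longrightarrow> v \<noteq> m \<Longrightarrow> (m, v) \<in> R"
    and link_nonempty: "v \<in> vertices X \<Longrightarrow> v \<noteq> m \<Longrightarrow> descending_link R X v \<noteq> {}"
    and h_cont: "v \<in> vertices X \<Longrightarrow> v \<noteq> m \<Longrightarrow>
      continuous_map (prod_topology unit_interval (realisation (descending_link R X v)))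
        (realisation (descending_link R X v)) (h v)"
    and h_0: "v \<in> vertices X \<Longrightarrow> v \<noteq> m \<Longrightarrow> y \<in> realisation_points (descending_link R X v) \<Longrightarrow> h v (0, y) = y"
    and h_1: "v \<in> vertices X \<Longrightarrow> v \<noteq> m \<Longrightarrow> y \<in> realisation_points (descending_link R X v) \<Longrightarrow>
      z \<in> realisation_points (descending_link R X v) \<Longrightarrow> h v (1, y) = h v (1, z)"
begin

abbreviation link :: "'v \<Rightarrow> 'v set set" where
  "link \<equiv> descending_link R X"

definition top_vertex :: "('v \<Rightarrow> real) \<Rightarrow> 'v" where
  "top_vertex p = (THE v. p v \<noteq> 0 \<and> (\<forall>w. p w \<noteq> 0 \<longrightarrow> w = v \<or> (w, v) \<in> R))"

text \<open>
  A base point below \<open>p\<close> in the cone whose tip is the top vertex of \<open>p\<close>. It is unique unless \<open>p\<close> is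
  the tip itself, where any point of the link is admitted.
\<close>

definition link_point :: "('v \<Rightarrow> real) \<Rightarrow> 'v \<Rightarrow> real" where
  "link_point p = (SOME y. y \<in> realisation_points (link (top_vertex p)) \<and>
     p = join_point (top_vertex p) (p (top_vertex p)) y)"

text \<open>
  The path of the point with cone coordinates \<open>(s, y)\<close>. Up to time \<open>s / 4\<close> it runs along the
  contraction of the link at constant height \<open>s\<close>, until the contraction has reached the time \<open>s\<close>. Up
  to time \<open>s / 2\<close> it descends to height \<open>0\<close>, arriving at the point \<open>h v (s, y)\<close> of the link. From
  then on it follows the path of that point under \<open>F\<close>, reparametrised to the remaining time.

  Using the height both as the stopping time of the contraction and as the measure of the time spent
  has two effects. At \<open>s = 0\<close> nothing is done and no time is lost, so the path of a point of the link
  is the one it already had. At \<open>s = 1\<close> the path does not depend on \<open>y\<close>: the point rests at the tip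
  until the contraction has finished and only then descends.

  The bounds by \<open>0\<close> do not change the values; they keep the arguments in the unit interval for all
  \<open>t\<close> and \<open>s\<close>, so that each branch is continuous everywhere and not just where it applies.
\<close>

definition track ::
  "'v \<Rightarrow> (('v \<Rightarrow> real) \<Rightarrow> real \<Rightarrow> 'v \<Rightarrow> real) \<Rightarrow> real \<Rightarrow> real \<Rightarrow> ('v \<Rightarrow> real) \<Rightarrow> 'v \<Rightarrow> real" where
  "track v F t s y =
     (if t \<le> s / 2 then join_point v (max 0 (min s (2 * s - 4 * t))) (h v (min (4 * t) s, y))
      else F (h v (s, y)) (max 0 ((t - s / 2) / (1 - s / 2))))"

text \<open>
  The contraction of the whole complex, obtained by following these paths. Each round lowers the top
  vertex, so the recursion is well-founded, although the number of rounds need not have a common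
  bound for all points.
\<close>

definition slide :: "('v \<Rightarrow> real) \<Rightarrow> real \<Rightarrow> 'v \<Rightarrow> real" where
  "slide = wfrec (inv_image R top_vertex) (\<lambda>F p t.
     if top_vertex p = m then p else track (top_vertex p) F t (p (top_vertex p)) (link_point p))"

lemma top_vertexI:
  assumes "p v \<noteq> 0" "\<And>w. p w \<noteq> 0 \<Longrightarrow> w = v \<or> (w, v) \<in> R"
  shows "top_vertex p = v"
  unfolding top_vertex_def
proof (rule the_equality)
  fix u assume "p u \<noteq> 0 \<and> (\<forall>w. p w \<noteq> 0 \<longrightarrow> w = u \<or> (w, u) \<in> R)"
  then show "u = v"
    using assms strict_well_order_asym[OF order] by metis
qed (use assms in auto)

lemma linkD:
  assumes "\<tau> \<in> link v"
  shows "v \<notin> \<tau>" "finite \<tau>" "\<tau> \<noteq> {}" "insert v \<tau> \<in> X" "\<tau> \<in> X" "\<And>w. w \<in> \<tau> \<Longrightarrow> (w, v) \<in> R"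
proof -
  show "v \<notin> \<tau>" "\<tau> \<noteq> {}" "insert v \<tau> \<in> X" "\<And>w. w \<in> \<tau> \<Longrightarrow> (w, v) \<in> R"
    using assms strict_well_order_asym[OF order] by (auto simp: descending_link_def)
  then show "finite \<tau>" "\<tau> \<in> X"
    using complex unfolding abstract_complex_def by (metis finite_insert, metis subset_insertI)
qed

lemma link_realisationD:
  assumes "y \<in> realisation_points (link v)"
  shows "y \<in> realisation_points X" "y v = 0" "\<And>w. y w \<noteq> 0 \<Longrightarrow> (w, v) \<in> R"
  using assms linkD by (fastforce simp: realisation_points_def closed_cell_def)+

text \<open>
  The cells that are cones over a non-empty cell are cofinal. Nonemptiness of the link handles the
  remaining case \<open>\<sigma> = {v}\<close>, which has no base.
\<close>

lemma cell_in_cone: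
  assumes \<sigma>: "\<sigma> \<in> X" "v \<in> \<sigma>" "\<And>w. w \<in> \<sigma> \<Longrightarrow> w = v \<or> (w, v) \<in> R" and "v \<noteq> m"
  obtains \<tau> where "\<tau> \<in> link v" "\<sigma> \<subseteq> insert v \<tau>"
proof (cases "\<sigma> = {v}")
  case True
  have "v \<in> vertices X"
    using \<sigma> by (auto simp: vertices_def)
  then show ?thesis
    using link_nonempty[OF _ assms(4)] that True by blast
next
  case False
  then have "\<sigma> - {v} \<in> link v"
    using \<sigma> by (auto simp: descending_link_def insert_absorb)
  then show ?thesis
    using that by blast
qed

lemma top_vertex_properties:
  assumes p: "p \<in> realisation_points X"
  defines "v \<equiv> top_vertex p"
  shows "v \<in> vertices X" "0 < p v" "p v \<le> 1"
    "v = m \<Longrightarrow> p = (\<lambda>w. if w = m then 1 else 0)"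
    "v \<noteq> m \<Longrightarrow> link_point p \<in> realisation_points (link v) \<and> p = join_point v (p v) (link_point p)"
proof -
  obtain \<rho> where \<rho>: "\<rho> \<in> X" "p \<in> closed_cell \<rho>"
    using p by (auto simp: realisation_points_def)
  \<comment> \<open>the open cell containing \<open>p\<close> is the one of its support\<close>
  define \<sigma> where "\<sigma> = {w. p w \<noteq> 0}"
  have sub: "\<sigma> \<subseteq> \<rho>"
    using \<rho>(2) by (auto simp: closed_cell_def \<sigma>_def)
  have "finite \<rho>"
    using \<rho>(1) complex by (simp add: abstract_complex_def)
  then have fin: "finite \<sigma>"
    using sub finite_subset by blast
  have "sum p \<sigma> = sum p \<rho>"
    using sub \<open>finite \<rho>\<close> by (intro sum.mono_neutral_left) (auto simp: \<sigma>_def)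
  then have cell: "p \<in> closed_cell \<sigma>"
    using \<rho>(2) by (auto simp: closed_cell_def \<sigma>_def)
  have ne: "\<sigma> \<noteq> {}"
    using cell by (auto simp: closed_cell_def)
  have \<sigma>X: "\<sigma> \<in> X"
    using \<rho>(1) sub ne complex unfolding abstract_complex_def by blast
  obtain u where u: "u \<in> \<sigma>" "\<And>w. w \<in> \<sigma> \<Longrightarrow> w = u \<or> (w, u) \<in> R"
    using finite_has_greatest[OF order fin ne] by blast
  have uv: "u = v"
    using top_vertexI[of p u] u by (auto simp: \<sigma>_def v_def)
  show vX: "v \<in> vertices X"
    using u \<sigma>X uv by (auto simp: vertices_def)
  have nn: "0 \<le> p w" for w
    using cell by (simp add: closed_cell_def)
  then show pos: "0 < p v"
    using u uv by (auto simp: \<sigma>_def order_less_le)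
  show le1: "p v \<le> 1"
    using member_le_sum[OF u(1), of p] nn fin cell uv by (auto simp: closed_cell_def)
  show "p = (\<lambda>w. if w = m then 1 else 0)" if "v = m"
  proof -
    have "w = m" if "w \<in> \<sigma>" for w
      using u(2)[OF that] least[of w] that \<sigma>X uv \<open>v = m\<close> strict_well_order_asym[OF order]
      by (auto simp: vertices_def)
    then have "\<sigma> = {m}"
      using ne by blast
    then show ?thesis
      using cell by (auto simp: closed_cell_def)
  qed
  show "link_point p \<in> realisation_points (link v) \<and> p = join_point v (p v) (link_point p)" if "v \<noteq> m"
  proof -
    obtain \<tau> where \<tau>: "\<tau> \<in> link v" "\<sigma> \<subseteq> insert v \<tau>"
      using cell_in_cone[OF \<sigma>X, of v] u uv \<open>v \<noteq> m\<close> by blast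
    have "p \<in> closed_cell (insert v \<tau>)"
      using closed_cell_mono[OF \<tau>(2)] linkD(2)[OF \<tau>(1)] cell by auto
    then obtain s y where sy: "y \<in> closed_cell \<tau>" "p = join_point v s y"
      using join_point_surj linkD(1-3)[OF \<tau>(1)] by metis
    have y: "y \<in> realisation_points (link v)"
      using sy(1) \<tau>(1) by (auto simp: realisation_points_def)
    have "p v = s"
      using link_realisationD(2)[OF y] sy(2) by (simp add: join_point_def)
    then have "\<exists>y. y \<in> realisation_points (link v) \<and> p = join_point v (p v) y"
      using sy y by blast
    then show ?thesis
      unfolding link_point_def v_def by (rule someI_ex)
  qed
qed

lemma h_in_link:
  assumes "v \<in> vertices X" "v \<noteq> m" "y \<in> realisation_points (link v)" "0 \<le> s" "s \<le> 1"
  shows "h v (s, y) \<in> realisation_points (link v)"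
  using continuous_map_funspace[OF h_cont[OF assms(1,2)]] assms(3-5)
  by (auto simp: topspace_realisation)

lemma top_vertex_link:
  assumes "y \<in> realisation_points (link v)"
  shows "(top_vertex y, v) \<in> R"
  using top_vertex_properties(2)[OF link_realisationD(1)[OF assms]] link_realisationD(3)[OF assms] by auto

lemma slide_unfold:
  assumes p: "p \<in> realisation_points X"
  shows "slide p t = (if top_vertex p = m then p
    else track (top_vertex p) slide t (p (top_vertex p)) (link_point p))"
proof -
  define v where "v = top_vertex p"
  define r where "r = inv_image R top_vertex"
  have "wf r"
    using order by (simp add: strict_well_order_def r_def)
  then have "slide p t = (if v = m then p else track v (cut slide r p) t (p v) (link_point p))"
    unfolding slide_def r_def v_def by (subst wfrec) auto
  moreover have "cut slide r p (h v (p v, link_point p)) = slide (h v (p v, link_point p))" if "v \<noteq> m"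
  proof (rule cut_apply)
    have "h v (p v, link_point p) \<in> realisation_points (link v)"
      using top_vertex_properties[OF p] that h_in_link[of v] by (simp add: v_def less_imp_le)
    then show "(h v (p v, link_point p), p) \<in> r"
      using top_vertex_link by (simp add: r_def v_def)
  qed
  ultimately show ?thesis
    by (simp add: track_def flip: v_def)
qed

lemma slide_0:
  assumes p: "p \<in> realisation_points X"
  shows "slide p 0 = p"
  using slide_unfold[OF p, of 0] top_vertex_properties[OF p] by (auto simp: track_def h_0)

lemma slide_1:
  assumes "p \<in> realisation_points X"
  shows "slide p 1 = (\<lambda>w. if w = m then 1 else 0)"
proof -
  have "wf (inv_image R top_vertex)"
    using order by (simp add: strict_well_order_def)
  then show ?thesis
    using assms
  proof (induction p rule: wf_induct_rule)
    case (less p)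
    define v where "v = top_vertex p"
    note v = top_vertex_properties[OF less.prems, folded v_def]
    show ?case
    proof (cases "v = m")
      case True
      then show ?thesis
        using slide_unfold[OF less.prems] v(4) v_def by simp
    next
      case False
      let ?q = "h v (p v, link_point p)"
      have q: "?q \<in> realisation_points (link v)"
        using h_in_link v False by simp
      have "slide p 1 = slide ?q 1"
        using slide_unfold[OF less.prems, of 1] v(3) False by (simp add: track_def flip: v_def)
      then show ?thesis
        using less.IH[of ?q] top_vertex_link[OF q] link_realisationD(1)[OF q] by (simp add: v_def)
    qed
  qed
qed

lemma track_cone_point:
  assumes "v \<in> vertices X" "v \<noteq> m" "y \<in> realisation_points (link v)" "z \<in> realisation_points (link v)"
  shows "track v F t 1 y = track v F t 1 z"
proof -
  have "join_point v (max 0 (min 1 (2 - 4 * t))) (h v (min (4 * t) 1, y)) =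
      join_point v (max 0 (min 1 (2 - 4 * t))) (h v (min (4 * t) 1, z))"
    using h_1[OF assms] join_point_1 by (cases "t \<le> 1 / 4") (auto simp: min_def max_def)
  then show ?thesis
    unfolding track_def by (simp only: h_1[OF assms] mult_1_right)
qed

lemma join_point_in_realisation:
  assumes y: "y \<in> realisation_points (link v)" and s: "0 \<le> s" "s \<le> 1"
  shows "join_point v s y \<in> realisation_points X"
proof -
  obtain \<tau> where "\<tau> \<in> link v" "y \<in> closed_cell \<tau>"
    using y by (auto simp: realisation_points_def)
  then show ?thesis
    using join_point_in_cell[of y \<tau> v s] linkD[of \<tau> v] s by (auto simp: realisation_points_def)
qed

text \<open>
  The recursion only speaks about cones at the top vertex, with the chosen base point. It extends to
  the whole closed cone at any \<open>v \<noteq> m\<close> and to all cone coordinates, which makes it usable for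
  continuity: the base of the cone, where \<open>v\<close> is not the top vertex, is covered because \<open>track\<close> is
  trivial at height \<open>0\<close>, and the tip because \<open>track\<close> ignores the base point at height \<open>1\<close>.
\<close>

lemma slide_join_point:
  assumes v: "v \<in> vertices X" "v \<noteq> m" and y: "y \<in> realisation_points (link v)"
    and s: "0 \<le> s" "s \<le> 1" and t: "0 \<le> t"
  shows "slide (join_point v s y) t = track v slide t s y"
proof (cases "s = 0")
  case True
  then show ?thesis
    using h_0[OF v y] slide_0[OF link_realisationD(1)[OF y]] t by (auto simp: track_def)
next
  case False
  let ?p = "join_point v s y"
  have p: "?p \<in> realisation_points X"
    using join_point_in_realisation[OF y s] .
  have pv: "?p v = s"
    using link_realisationD(2)[OF y] by (simp add: join_point_def)
  have top: "top_vertex ?p = v"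
  proof (rule top_vertexI)
    show "w = v \<or> (w, v) \<in> R" if "?p w \<noteq> 0" for w
      using that link_realisationD(3)[OF y, of w] by (auto simp: join_point_def split: if_splits)
  qed (use pv False in simp)
  define z where "z = link_point ?p"
  have z: "z \<in> realisation_points (link v)" "?p = join_point v s z"
    using top_vertex_properties(5)[OF p] top v(2) pv by (auto simp: z_def)
  have "track v slide t s z = track v slide t s y"
  proof (cases "s = 1")
    case True
    then show ?thesis
      using track_cone_point[OF v z(1) y] by simp
  next
    case False
    have "z w = y w" for w
    proof (cases "w = v")
      case True
      then show ?thesis
        using link_realisationD(2)[OF y] link_realisationD(2)[OF z(1)] by simp
    next
      case neq: False
      show ?thesis
        using fun_cong[OF z(2), of w] False neq by (simp add: join_point_def)
    qed
    then have "z = y"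
      by blast
    then show ?thesis
      by simp
  qed
  then show ?thesis
    using slide_unfold[OF p, of t] top v(2) pv by (simp add: z_def)
qed

text \<open>
  The two branches of \<open>track\<close> cover closed sets and agree where they meet: at \<open>t = s / 2\<close> the first
  one has arrived at \<open>h v (s, y)\<close> and the second one starts there.
\<close>

lemma continuous_map_track:
  assumes v: "v \<in> vertices X" "v \<noteq> m"
    and below: "continuous_map (prod_topology unit_interval (realisation (link v))) (realisation X) (\<lambda>(t, p). slide p t)"
  shows "continuous_map (prod_topology unit_interval (prod_topology unit_interval (realisation (link v))))
    (realisation X) (\<lambda>(t, s, y). track v slide t s y)"
proof -
  let ?L = "realisation (link v)"
  let ?P = "prod_topology unit_interval (prod_topology unit_interval ?L)"
  have t: "continuous_map ?P unit_interval fst"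
    by (rule continuous_map_fst)
  have s: "continuous_map ?P unit_interval (\<lambda>z. fst (snd z))"
    using continuous_map_compose[OF continuous_map_snd continuous_map_fst] by (simp add: o_def)
  have y: "continuous_map ?P ?L (\<lambda>z. snd (snd z))"
    using continuous_map_compose[OF continuous_map_snd continuous_map_snd] by (simp add: o_def)
  have real: "continuous_map ?P (top_of_set T) (\<lambda>z. f (fst z) (fst (snd z)))"
    if "continuous_on ({0..1} \<times> {0..1}) (\<lambda>x. f (fst x) (snd x))"
      "\<And>t s. 0 \<le> t \<Longrightarrow> t \<le> 1 \<Longrightarrow> 0 \<le> s \<Longrightarrow> s \<le> 1 \<Longrightarrow> f t s \<in> T" for f :: "real \<Rightarrow> real \<Rightarrow> real" and T
  proof -
    have "continuous_map ?P (top_of_set ({0..1} \<times> {0..1})) (\<lambda>z. (fst z, fst (snd z)))"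
      using continuous_map_pairedI[OF t s] by simp
    moreover have "continuous_map (top_of_set ({0..1} \<times> {0..1})) (top_of_set T) (\<lambda>x. f (fst x) (snd x))"
      using that by (auto simp: continuous_map_in_subtopology)
    ultimately have "continuous_map ?P (top_of_set T) ((\<lambda>x. f (fst x) (snd x)) \<circ> (\<lambda>z. (fst z, fst (snd z))))"
      by (rule continuous_map_compose)
    then show ?thesis
      by (simp add: o_def)
  qed
  have hmap: "continuous_map ?P ?L (\<lambda>z. h v (g z, snd (snd z)))" if "continuous_map ?P unit_interval g" for g
    using continuous_map_compose[OF continuous_map_pairedI[OF that y] h_cont[OF v]] by (simp add: o_def)
  have 1: "continuous_map ?P (realisation X)
      (\<lambda>z. join_point v (max 0 (min (fst (snd z)) (2 * fst (snd z) - 4 * fst z)))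
             (h v (min (4 * fst z) (fst (snd z)), snd (snd z))))" (is "continuous_map _ _ ?f")
  proof -
    have a: "continuous_map ?P unit_interval (\<lambda>z. max 0 (min (fst (snd z)) (2 * fst (snd z) - 4 * fst z)))"
      by (rule real[of "\<lambda>t s. max 0 (min s (2 * s - 4 * t))"]) (auto intro!: continuous_intros)
    have b: "continuous_map ?P ?L (\<lambda>z. h v (min (4 * fst z) (fst (snd z)), snd (snd z)))"
      by (rule hmap, rule real[of "\<lambda>t s. min (4 * t) s"]) (auto intro!: continuous_intros)
    have c: "continuous_map (prod_topology unit_interval ?L) (realisation X) (\<lambda>(s, y). join_point v s y)"
      using linkD by (intro continuous_map_join) blast
    show ?thesis
      using continuous_map_compose[OF continuous_map_pairedI[OF a b] c] by (simp add: o_def)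
  qed
  have 2: "continuous_map ?P (realisation X)
      (\<lambda>z. slide (h v (fst (snd z), snd (snd z))) (max 0 ((fst z - fst (snd z) / 2) / (1 - fst (snd z) / 2))))"
      (is "continuous_map _ _ ?g")
  proof -
    have a: "continuous_map ?P unit_interval (\<lambda>z. max 0 ((fst z - fst (snd z) / 2) / (1 - fst (snd z) / 2)))"
      by (rule real[of "\<lambda>t s. max 0 ((t - s / 2) / (1 - s / 2))"])
        (auto intro!: continuous_intros simp: divide_le_eq)
    show ?thesis
      using continuous_map_compose[OF continuous_map_pairedI[OF a hmap[OF s]] below] by (simp add: o_def)
  qed
  have "continuous_map ?P (realisation X) (\<lambda>z. if fst z \<le> fst (snd z) / 2 then ?f z else ?g z)"
  proof (rule continuous_map_cases_le)
    have "continuous_map ?P (top_of_set UNIV) (\<lambda>z. fst z)"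
      by (rule real[of "\<lambda>t s. t"]) (auto intro!: continuous_intros)
    then show "continuous_map ?P euclideanreal fst"
      by simp
    have "continuous_map ?P (top_of_set UNIV) (\<lambda>z. fst (snd z) / 2)"
      by (rule real[of "\<lambda>t s. s / 2"]) (auto intro!: continuous_intros)
    then show "continuous_map ?P euclideanreal (\<lambda>z. fst (snd z) / 2)"
      by simp
    fix z assume z: "z \<in> topspace ?P" "fst z = fst (snd z) / 2"
    then have "h v (fst (snd z), snd (snd z)) \<in> realisation_points X"
      using h_in_link[OF v] link_realisationD(1)[of _ v] by (auto simp: topspace_realisation)
    then show "?f z = ?g z"
      using z by (auto simp: slide_0 max_def min_def)
  qed (rule continuous_map_from_subtopology[OF 1], rule continuous_map_from_subtopology[OF 2])
  then show ?thesis
    by (simp add: track_def case_prod_unfold)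
qed

text \<open>
  Induction on the greatest vertex \<open>v\<close> of the cell: all cells of the descending link have smaller
  greatest vertices, so the motion is continuous on the link, hence it is so on the cone over the
  link, which contains the given cell.
\<close>

lemma continuous_map_slide_cell:
  assumes "\<sigma> \<in> X" "v \<in> \<sigma>" "\<And>w. w \<in> \<sigma> \<Longrightarrow> w = v \<or> (w, v) \<in> R"
  shows "continuous_map (prod_topology unit_interval (top_of_set (closed_cell \<sigma>))) (realisation X) (\<lambda>(t, p). slide p t)"
proof -
  have "wf R"
    using order by (simp add: strict_well_order_def)
  then show ?thesis
    using assms
  proof (induction v arbitrary: \<sigma> rule: wf_induct_rule)
    case (less v \<sigma>)
    have vX: "v \<in> vertices X"
      using less.prems by (auto simp: vertices_def)
    show ?case
    proof (cases "v = m")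
      case True
      have "slide p t = p" if "p \<in> closed_cell \<sigma>" for p t
      proof -
        have p: "p \<in> realisation_points X"
          using that less.prems(1) by (auto simp: realisation_points_def)
        have "top_vertex p \<in> \<sigma>"
          using top_vertex_properties(2)[OF p] that by (auto simp: closed_cell_def)
        then have "top_vertex p = m"
          using less.prems(3) True least[of "top_vertex p"] top_vertex_properties(1)[OF p]
            strict_well_order_asym[OF order] by blast
        then show ?thesis
          using slide_unfold[OF p] by simp
      qed
      moreover have "continuous_map (prod_topology unit_interval (top_of_set (closed_cell \<sigma>))) (realisation X) snd"
        by (rule continuous_map_compose[OF continuous_map_snd continuous_map_cell_inclusion[OF less.prems(1)], unfolded o_def])
      ultimately show ?thesis
        by (elim continuous_map_eq) auto
    next
      case False
      have "continuous_map (prod_topology unit_interval (realisation (link v))) (realisation X) (\<lambda>(t, p). slide p t)"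
      proof (rule continuous_map_cylinder_realisation)
        fix \<tau> assume \<tau>: "\<tau> \<in> link v"
        then obtain u where "u \<in> \<tau>" "\<And>w. w \<in> \<tau> \<Longrightarrow> w = u \<or> (w, u) \<in> R"
          using finite_has_greatest[OF order linkD(2,3)] by blast
        then show "continuous_map (prod_topology unit_interval (top_of_set (closed_cell \<tau>))) (realisation X) (\<lambda>(t, p). slide p t)"
          using less.IH[of u \<tau>] linkD[OF \<tau>] by blast
      qed
      note T = continuous_map_track[OF vX False this]
      obtain \<tau> where \<tau>: "\<tau> \<in> link v" "\<sigma> \<subseteq> insert v \<tau>"
        using cell_in_cone[OF less.prems False] by blast
      let ?C = "top_of_set (closed_cell \<tau>)"
      let ?P = "prod_topology unit_interval (prod_topology unit_interval ?C)"
      have "continuous_map (prod_topology unit_interval ?C)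
          (prod_topology unit_interval (realisation (link v))) (\<lambda>(s, y). (s, y))"
        unfolding continuous_map_prod_top using continuous_map_cell_inclusion[OF \<tau>(1)] by auto
      then have "continuous_map ?P (prod_topology unit_interval
          (prod_topology unit_interval (realisation (link v)))) (\<lambda>(t, z). (t, (\<lambda>(s, y). (s, y)) z))"
        unfolding continuous_map_prod_top by auto
      from continuous_map_compose[OF this T]
      have "continuous_map ?P (realisation X) (\<lambda>(t, s, y). track v slide t s y)"
        by (simp add: o_def case_prod_unfold)
      then have "continuous_map ?P (realisation X)
          ((\<lambda>(t, p). slide p t) \<circ> (\<lambda>(t, z). (t, case z of (s, y) \<Rightarrow> join_point v s y)))"
        by (rule continuous_map_eq)
          (use slide_join_point[OF vX False] closed_cell_subset_realisation[OF \<tau>(1)] in auto)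
      then have "continuous_map (prod_topology unit_interval (top_of_set (closed_cell (insert v \<tau>))))
          (realisation X) (\<lambda>(t, p). slide p t)"
        by (rule continuous_compose_quotient_map[OF quotient_map_join_cell[OF linkD(1-3)[OF \<tau>(1)]]])
      then have "continuous_map (subtopology (prod_topology unit_interval (top_of_set (closed_cell (insert v \<tau>)))) (UNIV \<times> closed_cell \<sigma>))
          (realisation X) (\<lambda>(t, p). slide p t)"
        by (rule continuous_map_from_subtopology)
      moreover have "closed_cell (insert v \<tau>) \<inter> closed_cell \<sigma> = closed_cell \<sigma>"
        using closed_cell_mono[OF \<tau>(2)] linkD(2)[OF \<tau>(1)] by auto
      ultimately show ?thesis
        by (simp add: subtopology_subtopology Times_Int_Times)
    qed
  qed
qed

lemma contractible_realisation: "contractible_space (realisation X)"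
proof -
  have "continuous_map (prod_topology unit_interval (realisation X)) (realisation X) (\<lambda>(t, p). slide p t)"
  proof (rule continuous_map_cylinder_realisation)
    fix \<sigma> assume \<sigma>: "\<sigma> \<in> X"
    then have "finite \<sigma>" "\<sigma> \<noteq> {}"
      using complex by (auto simp: abstract_complex_def)
    from finite_has_greatest[OF order this]
    obtain v where v: "v \<in> \<sigma>" "\<And>w. w \<in> \<sigma> \<Longrightarrow> w = v \<or> (w, v) \<in> R"
      by blast
    show "continuous_map (prod_topology unit_interval (top_of_set (closed_cell \<sigma>))) (realisation X) (\<lambda>(t, p). slide p t)"
      using continuous_map_slide_cell[OF \<sigma> v] by blast
  qed
  then have "homotopic_with (\<lambda>x. True) (realisation X) (realisation X) id (\<lambda>p w. if w = m then 1 else 0)"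
    using slide_0 slide_1
    by (intro homotopic_with[THEN iffD2] exI[of _ "\<lambda>(t, p). slide p t"])
      (simp_all add: topspace_realisation)
  then show ?thesis
    unfolding contractible_space_def by blast
qed

end

section \<open>Descending links of exchange complexes\<close>

text \<open>
  The exchange condition relative to a strict well-order of the vertices instead of a colouring. A
  common neighbour of distinct non-adjacent vertices says that their distance is \<open>2\<close> without
  speaking about shortest paths, and for a linear order the final disjunction says that the apex is
  below the greater of \<open>u\<close> and \<open>w\<close>.
\<close>

definition exchange_order :: "('v \<times> 'v) set \<Rightarrow> 'v set set \<Rightarrow> bool" where
  "exchange_order R X \<longleftrightarrow> flag_complex X \<and> connected_complex X \<and>
     (\<forall>u\<in>vertices X. \<forall>w\<in>vertices X. u \<noteq> w \<and> \<not> adjacent X u w \<and> two_interval X u w \<noteq> {} \<longrightarrow>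
        (\<exists>x. is_apex X (two_interval X u w) x \<and> ((x, u) \<in> R \<or> (x, w) \<in> R)))"

lemma adjacent_sym: "adjacent X u w \<Longrightarrow> adjacent X w u"
  unfolding adjacent_def by (metis insert_commute)

lemma adjacent_vertices:
  "adjacent X u w \<Longrightarrow> u \<in> vertices X \<and> w \<in> vertices X"
  by (auto simp: adjacent_def vertices_def)

lemma exchange_apex:
  assumes "exchange_order R X" "adjacent X v u" "adjacent X v w" "u \<noteq> w" "\<not> adjacent X u w"
  obtains x where "is_apex X (two_interval X u w) x" "adjacent X u x" "adjacent X w x"
    "(x, u) \<in> R \<or> (x, w) \<in> R"
proof -
  have "v \<in> two_interval X u w"
    using assms(2,3) adjacent_sym adjacent_vertices by (fastforce simp: two_interval_def)
  then have "\<exists>x. is_apex X (two_interval X u w) x \<and> ((x, u) \<in> R \<or> (x, w) \<in> R)"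
    using assms adjacent_vertices[OF assms(2)] adjacent_vertices[OF assms(3)]
    unfolding exchange_order_def by blast
  then show ?thesis
    using that by (auto simp: is_apex_def two_interval_def)
qed

definition path_within :: "'v set set \<Rightarrow> 'v set \<Rightarrow> 'v \<Rightarrow> 'v \<Rightarrow> bool" where
  "path_within X B = (\<lambda>u w. adjacent X u w \<and> u \<in> B \<and> w \<in> B)\<^sup>*\<^sup>*"

lemma path_within_mono:
  assumes "path_within X B u w" "B \<subseteq> C"
  shows "path_within X C u w"
proof -
  have "(\<lambda>u w. adjacent X u w \<and> u \<in> B \<and> w \<in> B) \<le> (\<lambda>u w. adjacent X u w \<and> u \<in> C \<and> w \<in> C)"
    using assms(2) by auto
  from predicate2D[OF rtranclp_mono[OF this]] show ?thesis
    using assms(1) unfolding path_within_def .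
qed

lemma path_within_step:
  "path_within X B u w \<Longrightarrow> adjacent X w x \<Longrightarrow> w \<in> B \<Longrightarrow> x \<in> B \<Longrightarrow> path_within X B u x"
  unfolding path_within_def by (erule rtranclp.rtrancl_into_rtrancl) simp

lemma path_has_greatest_vertex:
  assumes R: "strict_well_order R" and path: "path_within X B u w" and u: "u \<in> B"
  shows "\<exists>M\<in>B. path_within X {x. x = M \<or> (x, M) \<in> R} u w \<and> (w = M \<or> (w, M) \<in> R)"
  using path unfolding path_within_def
proof (induction rule: rtranclp_induct)
  case base
  then show ?case
    using u by blast
next
  case (step y z)
  then obtain M where M: "M \<in> B" "path_within X {x. x = M \<or> (x, M) \<in> R} u y" "y = M \<or> (y, M) \<in> R"
    by (auto simp: path_within_def)
  have tr: "\<And>a b c. (a, b) \<in> R \<Longrightarrow> (b, c) \<in> R \<Longrightarrow> (a, c) \<in> R"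
    using R by (meson strict_well_order_def transD)
  show ?case
  proof (cases "(M, z) \<in> R")
    case True
    then have "path_within X {x. x = z \<or> (x, z) \<in> R} u y" "y = z \<or> (y, z) \<in> R"
      using M tr by (auto elim!: path_within_mono)
    then have "path_within X {x. x = z \<or> (x, z) \<in> R} u z"
      using step(2) by (auto elim: path_within_step)
    then show ?thesis
      using step(2) unfolding path_within_def by blast
  next
    case False
    then have z: "z = M \<or> (z, M) \<in> R"
      using R by (metis strict_well_order_cases)
    then have "path_within X {x. x = M \<or> (x, M) \<in> R} u z"
      using path_within_step[OF M(2)] step(2) M(3) by auto
    then show ?thesis
      using M(1) z unfolding path_within_def by blast
  qed
qed

text \<open>
  The exchange argument proper. Every visit of the path to its greatest vertex \<open>M\<close> comes from some
  \<open>u'\<close> and continues to some \<open>z\<close>, both below \<open>M\<close>. These are equal, adjacent, or at distance \<open>2\<close>, and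
  in the last case an apex below \<open>u'\<close> or \<open>z\<close> replaces \<open>M\<close>. For the induction along the path, a path
  that currently ends at \<open>M\<close> is remembered by its last stop \<open>u'\<close> before \<open>M\<close>.
\<close>

lemma path_avoids_greatest_vertex:
  assumes R: "strict_well_order R" and X: "exchange_order R X"
    and path: "path_within X {x. x = M \<or> (x, M) \<in> R} u w" and u: "(u, M) \<in> R" and w: "(w, M) \<in> R"
  shows "path_within X {x. (x, M) \<in> R} u w"
proof -
  let ?B = "{x. (x, M) \<in> R}"
  have irrefl: "(M, M) \<notin> R"
    using strict_well_order_asym[OF R] by blast
  have "((w, M) \<in> R \<longrightarrow> path_within X ?B u w) \<and>
      (w = M \<longrightarrow> (\<exists>u'\<in>?B. path_within X ?B u u' \<and> adjacent X u' M))"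
    using path unfolding path_within_def[of X "{x. x = M \<or> (x, M) \<in> R}"]
  proof (induction rule: rtranclp_induct)
    case base
    then show ?case
      using u irrefl by (auto simp: path_within_def)
  next
    case (step y z)
    show ?case
    proof (intro conjI impI)
      assume z: "(z, M) \<in> R"
      show "path_within X ?B u z"
      proof (cases "y = M")
        case True
        then obtain u' where u': "(u', M) \<in> R" "path_within X ?B u u'" "adjacent X u' M"
          using step.IH by blast
        consider "u' = z" | "adjacent X u' z" | "u' \<noteq> z" "\<not> adjacent X u' z"
          by blast
        then show ?thesis
        proof cases
          case 3
          obtain x where x: "adjacent X u' x" "adjacent X z x" "(x, u') \<in> R \<or> (x, z) \<in> R"
            using exchange_apex[OF X adjacent_sym[OF u'(3)] _ 3] step(2) True by blast
          then have "(x, M) \<in> R"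
            using u'(1) z R by (meson strict_well_order_def transD)
          then show ?thesis
            using path_within_step[OF path_within_step[OF u'(2)]] x(1) adjacent_sym[OF x(2)] u'(1) z by auto
        qed (use u' z path_within_step[OF u'(2)] in auto)
      next
        case False
        then show ?thesis
          using step z by (auto elim: path_within_step)
      qed
    next
      assume "z = M"
      then have "y \<noteq> M" "adjacent X y M"
        using step(2) by (auto simp: adjacent_def)
      then show "\<exists>u'\<in>?B. path_within X ?B u u' \<and> adjacent X u' M"
        using step by auto
    qed
  qed
  then show ?thesis
    using w by blast
qed

text \<open>
  A path from \<open>u\<close> up to \<open>v\<close> can be pushed down, by induction on its greatest vertex, until this
  vertex is \<open>v\<close>. The last step of such a path enters \<open>v\<close> from below.
\<close>

lemma lower_neighbour:
  assumes R: "strict_well_order R" and X: "exchange_order R X"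
    and v: "v \<in> vertices X" and u: "u \<in> vertices X" "(u, v) \<in> R"
  shows "\<exists>w. adjacent X w v \<and> (w, v) \<in> R"
proof -
  have down: "path_within X {x. x = v \<or> (x, v) \<in> R} u v"
    if "path_within X {x. x = M \<or> (x, M) \<in> R} u v" "v = M \<or> (v, M) \<in> R" for M
  proof -
    have "wf R"
      using R by (simp add: strict_well_order_def)
    then show ?thesis
      using that
    proof (induction M rule: wf_induct_rule)
      case (less M)
      show ?case
      proof (cases "v = M")
        case False
        then have vM: "(v, M) \<in> R"
          using less.prems by blast
        then have uM: "(u, M) \<in> R"
          using u R by (meson strict_well_order_def transD)
        have "path_within X {x. (x, M) \<in> R} u v"
          by (rule path_avoids_greatest_vertex[OF R X less.prems(1) uM vM])
        from path_has_greatest_vertex[OF R this] show ?thesis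
          using uM less.IH by auto
      qed (use less.prems in simp)
    qed
  qed
  obtain n where "(adjacent X ^^ n) u v"
    using X u v unfolding exchange_order_def connected_complex_def by blast
  then have "path_within X UNIV u v"
    unfolding path_within_def by (simp add: relpowp_imp_rtranclp)
  from path_has_greatest_vertex[OF R this]
  have "path_within X {x. x = v \<or> (x, v) \<in> R} u v"
    using down by blast
  then show ?thesis
    unfolding path_within_def
  proof (cases rule: rtranclp.cases)
    case rtrancl_refl
    then show ?thesis
      using u strict_well_order_asym[OF R] by blast
  next
    case (rtrancl_into_rtrancl w)
    then show ?thesis
      by (auto simp: adjacent_def)
  qed
qed

lemma descending_link_subset:
  assumes "abstract_complex X"
  shows "descending_link R X v \<subseteq> X"
proof
  fix \<tau> assume "\<tau> \<in> descending_link R X v"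
  then show "\<tau> \<in> X"
    using abstract_complex_face[OF assms, of "insert v \<tau>" \<tau>] by (auto simp: descending_link_def)
qed

lemma vertices_descending_link:
  assumes "strict_well_order R" "abstract_complex X"
  shows "w \<in> vertices (descending_link R X v) \<longleftrightarrow> adjacent X v w \<and> (w, v) \<in> R"
proof
  assume "w \<in> vertices (descending_link R X v)"
  then obtain \<tau> where \<tau>: "w \<in> \<tau>" "insert v \<tau> \<in> X" "\<forall>w\<in>\<tau>. (w, v) \<in> R"
    by (auto simp: vertices_def descending_link_def)
  then have "{v, w} \<in> X"
    using abstract_complex_face[OF assms(2) \<tau>(2), of "{v, w}"] by simp
  then show "adjacent X v w \<and> (w, v) \<in> R"
    using \<tau> strict_well_order_asym[OF assms(1)] by (auto simp: adjacent_def)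
next
  assume "adjacent X v w \<and> (w, v) \<in> R"
  then have "{w} \<in> descending_link R X v"
    by (simp add: descending_link_def adjacent_def)
  then show "w \<in> vertices (descending_link R X v)"
    by (auto simp: vertices_def)
qed

lemma flag_descending_link:
  assumes R: "strict_well_order R" and X: "flag_complex X"
  shows "flag_complex (descending_link R X v)"
proof -
  let ?L = "descending_link R X v"
  have ac: "abstract_complex X"
    using X by (simp add: flag_complex_def)
  note vL = vertices_descending_link[OF R ac]
  have "abstract_complex ?L"
    unfolding abstract_complex_def
  proof (intro conjI ballI allI impI)
    fix \<sigma> assume \<sigma>: "\<sigma> \<in> ?L"
    then have *: "\<sigma> \<noteq> {}" "insert v \<sigma> \<in> X" "\<forall>w\<in>\<sigma>. (w, v) \<in> R"
      by (auto simp: descending_link_def)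
    have "finite (insert v \<sigma>)"
      by (rule abstract_complex_finite[OF ac *(2)])
    then show "finite \<sigma>" "\<sigma> \<noteq> {}"
      using *(1) by simp_all
    fix \<tau> assume "\<tau> \<subseteq> \<sigma> \<and> \<tau> \<noteq> {}"
    then have \<tau>: "insert v \<tau> \<subseteq> insert v \<sigma>" "\<forall>w\<in>\<tau>. (w, v) \<in> R" "\<tau> \<noteq> {}"
      using *(3) by auto
    moreover have "insert v \<tau> \<in> X"
      by (rule abstract_complex_face[OF ac *(2) \<tau>(1)]) simp
    ultimately show "\<tau> \<in> ?L"
      by (simp add: descending_link_def)
  qed
  moreover have "S \<in> ?L" if S: "finite S" "S \<noteq> {}" "clique ?L S" for S
  proof -
    have low: "adjacent X v w \<and> (w, v) \<in> R" if "w \<in> S" for w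
    proof -
      have "w \<in> vertices ?L"
        using S(3) that by (auto simp: clique_def)
      then show ?thesis
        by (simp add: vL)
    qed
    have "adjacent X u w" if "u \<in> S" "w \<in> S" "u \<noteq> w" for u w
    proof -
      have "adjacent ?L u w"
        using S(3) that by (simp add: clique_def)
      then show ?thesis
        using descending_link_subset[OF ac, of R v] by (auto simp: adjacent_def)
    qed
    moreover have "insert v S \<subseteq> vertices X"
      using low adjacent_vertices[of X v] S(2) by blast
    ultimately have "clique X (insert v S)"
      using low adjacent_sym[of X v] by (simp add: clique_def)
    then have "insert v S \<in> X"
      using X S(1) by (simp add: flag_complex_def)
    then show ?thesis
      using S(2) low by (simp add: descending_link_def)
  qed
  ultimately show ?thesis
    unfolding flag_complex_def by blast
qed

lemma adjacent_descending_link: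
  assumes R: "strict_well_order R" and X: "flag_complex X"
    and "u \<in> vertices (descending_link R X v)" "w \<in> vertices (descending_link R X v)"
  shows "adjacent (descending_link R X v) u w \<longleftrightarrow> adjacent X u w"
proof
  have ac: "abstract_complex X"
    using X by (simp add: flag_complex_def)
  show "adjacent X u w" if "adjacent (descending_link R X v) u w"
    using that descending_link_subset[OF ac] unfolding adjacent_def by blast
  assume uw: "adjacent X u w"
  have *: "adjacent X v u" "(u, v) \<in> R" "adjacent X v w" "(w, v) \<in> R"
    using assms(3,4) vertices_descending_link[OF R ac] by blast+
  have "clique X {v, u, w}"
    using uw * adjacent_sym[OF uw] adjacent_sym[OF *(1)] adjacent_sym[OF *(3)] adjacent_vertices[OF uw]
      adjacent_vertices[OF *(1)] by (auto simp: clique_def)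
  then have "{v, u, w} \<in> X"
    using X by (simp add: flag_complex_def)
  then show "adjacent (descending_link R X v) u w"
    using * uw by (simp add: adjacent_def descending_link_def)
qed

text \<open>
  Two distinct non-adjacent vertices of the descending link have \<open>v\<close> as a common neighbour, so their
  two-interval in \<open>X\<close> has an apex \<open>x\<close> below one of them, and therefore below \<open>v\<close>. As an apex, \<open>x\<close> is
  adjacent to \<open>v\<close>, which puts it into the link. Thus the link inherits the exchange condition, and it
  is connected, any two of its vertices being at distance at most \<open>2\<close>.
\<close>

lemma exchange_order_descending_link:
  assumes R: "strict_well_order R" and X: "exchange_order R X"
  shows "exchange_order R (descending_link R X v)"
proof -
  let ?L = "descending_link R X v"
  have flag: "flag_complex X"
    using X by (simp add: exchange_order_def)
  then have ac: "abstract_complex X"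
    by (simp add: flag_complex_def)
  note vL = vertices_descending_link[OF R ac]
  note adj = adjacent_descending_link[OF R flag]
  have apex: "\<exists>x. is_apex ?L (two_interval ?L u w) x \<and> ((x, u) \<in> R \<or> (x, w) \<in> R)"
    if u: "u \<in> vertices ?L" and w: "w \<in> vertices ?L" and "u \<noteq> w" "\<not> adjacent ?L u w" for u w
  proof -
    have uw: "adjacent X v u" "(u, v) \<in> R" "adjacent X v w" "(w, v) \<in> R"
      using u w vL by blast+
    obtain x where x: "is_apex X (two_interval X u w) x" "adjacent X u x" "adjacent X w x"
        "(x, u) \<in> R \<or> (x, w) \<in> R"
      using exchange_apex[OF X uw(1,3) \<open>u \<noteq> w\<close>] \<open>\<not> adjacent ?L u w\<close> adj[OF u w] by blast
    have xv: "(x, v) \<in> R"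
      using x(4) uw R by (meson strict_well_order_def transD)
    have "v \<in> two_interval X u w"
      using uw adjacent_sym adjacent_vertices by (fastforce simp: two_interval_def)
    then have "adjacent X v x"
      using x(1) xv strict_well_order_asym[OF R] adjacent_sym unfolding is_apex_def by metis
    then have xL: "x \<in> vertices ?L"
      using xv vL by blast
    have "two_interval ?L u w \<subseteq> two_interval X u w"
    proof
      fix y assume y: "y \<in> two_interval ?L u w"
      then have "y \<in> vertices ?L"
        by (simp add: two_interval_def)
      then show "y \<in> two_interval X u w"
        using y adj[OF u] adj[OF w] adjacent_vertices[of X u y] by (auto simp: two_interval_def)
    qed
    moreover have "x \<in> two_interval ?L u w"
      using x(2,3) xL adj[OF u xL] adj[OF w xL] by (simp add: two_interval_def)
    moreover have "adjacent ?L x y" if "y \<in> two_interval ?L u w" "adjacent X x y" for y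
      using that adj[OF xL, of y] by (simp add: two_interval_def)
    ultimately have "is_apex ?L (two_interval ?L u w) x"
      using x(1) unfolding is_apex_def by blast
    then show ?thesis
      using x(4) by blast
  qed
  have "\<exists>n. (adjacent ?L ^^ n) u w" if u: "u \<in> vertices ?L" and w: "w \<in> vertices ?L" for u w
  proof -
    consider "u = w" | "adjacent ?L u w" | "u \<noteq> w" "\<not> adjacent ?L u w"
      by blast
    then have "(adjacent ?L)\<^sup>*\<^sup>* u w"
    proof cases
      case 3
      obtain x where "is_apex ?L (two_interval ?L u w) x"
        using apex[OF u w 3] by blast
      then have "adjacent ?L u x" "adjacent ?L w x"
        by (simp_all add: is_apex_def two_interval_def)
      then show ?thesis
        using adjacent_sym[of ?L w x] by (simp add: converse_rtranclp_into_rtranclp)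
    qed auto
    then show ?thesis
      by (rule rtranclp_imp_relpowp)
  qed
  then have "connected_complex ?L"
    by (simp add: connected_complex_def)
  then show ?thesis
    using flag_descending_link[OF R flag] apex by (simp add: exchange_order_def)
qed

lemma descending_link_nonempty:
  assumes R: "strict_well_order R" and X: "exchange_order R X"
    and "v \<in> vertices X" "u \<in> vertices X" "(u, v) \<in> R"
  shows "descending_link R X v \<noteq> {}"
proof -
  obtain w where "adjacent X w v" "(w, v) \<in> R"
    using lower_neighbour[OF assms] by blast
  then have "{w} \<in> descending_link R X v"
    by (simp add: descending_link_def adjacent_def insert_commute)
  then show ?thesis
    by blast
qed

section \<open>Contractibility\<close>

text \<open>
  Every vertex other than the least one is attached along a contractible complex, so nothing changes
  up to homotopy; the sliding motion does this for all vertices at once. The links also have to be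
  non-empty, since a vertex with an empty descending link starts a new component.
\<close>

lemma contractible_of_contractible_links:
  assumes R: "strict_well_order R" and X: "abstract_complex X" "X \<noteq> {}"
    and links: "\<And>u v. u \<in> vertices X \<Longrightarrow> v \<in> vertices X \<Longrightarrow> (u, v) \<in> R \<Longrightarrow>
      descending_link R X v \<noteq> {} \<and> contractible_space (realisation (descending_link R X v))"
  shows "contractible_space (realisation X)"
proof -
  obtain \<sigma> where \<sigma>: "\<sigma> \<in> X"
    using X(2) by blast
  then have "\<sigma> \<noteq> {}"
    using X(1) by (simp add: abstract_complex_def)
  then obtain v0 where v0: "v0 \<in> vertices X"
    using \<sigma> by (auto simp: vertices_def)
  have "wf R"
    using R by (simp add: strict_well_order_def)
  then obtain m where m: "m \<in> vertices X" "\<And>u. (u, m) \<in> R \<Longrightarrow> u \<notin> vertices X"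
    using v0 by (rule wfE_min) blast
  have least: "(m, v) \<in> R" if "v \<in> vertices X" "v \<noteq> m" for v
    by (rule strict_well_order_cases[OF R, of m v]) (use m that in auto)
  define nullhomotopy where "nullhomotopy v h \<longleftrightarrow>
      continuous_map (prod_topology unit_interval (realisation (descending_link R X v)))
        (realisation (descending_link R X v)) h \<and>
      (\<forall>y. h (0, y) = y) \<and> (\<exists>a. \<forall>y. h (1, y) = a)" for v h
  have "\<exists>h. nullhomotopy v h" if "v \<in> vertices X" "v \<noteq> m" for v
  proof -
    have "contractible_space (realisation (descending_link R X v))"
      using links[OF m(1) that(1) least[OF that]] by blast
    then obtain a k where k: "continuous_map (prod_topology unit_interval (realisation (descending_link R X v)))
        (realisation (descending_link R X v)) k" "\<forall>y. k (0, y) = id y" "\<forall>y. k (1, y) = a"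
      unfolding contractible_space_def homotopic_with_def by metis
    have "nullhomotopy v k"
      using k(1,2) exI[of "\<lambda>a. \<forall>y. k (1, y) = a", OF k(3)] by (simp add: nullhomotopy_def)
    then show ?thesis
      by blast
  qed
  then obtain h where h: "\<And>v. v \<in> vertices X \<Longrightarrow> v \<noteq> m \<Longrightarrow> nullhomotopy v (h v)"
    by metis
  interpret contracted_links R X m h
  proof
    fix v assume v: "v \<in> vertices X" "v \<noteq> m"
    show "(m, v) \<in> R"
      by (rule least[OF v])
    then show "descending_link R X v \<noteq> {}"
      using links m(1) v by blast
    show "continuous_map (prod_topology unit_interval (realisation (descending_link R X v)))
        (realisation (descending_link R X v)) (h v)"
      using h[OF v] by (simp add: nullhomotopy_def)
    show "h v (0, y) = y" for y
      using h[OF v] by (simp add: nullhomotopy_def)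
    show "h v (1, y) = h v (1, z)" for y z
      using h[OF v] by (auto simp: nullhomotopy_def)
  qed (fact R X(1))+
  show ?thesis
    by (rule contractible_realisation)
qed

text \<open>
  The link of \<open>w\<close> in the descending link of \<open>v\<close> is a descending link of a smaller vertex, but in
  another exchange complex; hence the induction on \<open>v\<close> is over all complexes at once.
\<close>

lemma contractible_descending_link:
  assumes R: "strict_well_order R" and "exchange_order R X"
  shows "contractible_space (realisation (descending_link R X v))"
proof -
  have "wf R"
    using R by (simp add: strict_well_order_def)
  then show ?thesis
    using assms(2)
  proof (induction v arbitrary: X rule: wf_induct_rule)
    case (less v X)
    let ?L = "descending_link R X v"
    have L: "exchange_order R ?L"
      by (rule exchange_order_descending_link[OF R less.prems])
    then have ac: "abstract_complex ?L"
      by (simp add: exchange_order_def flag_complex_def)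
    show ?case
    proof (cases "?L = {}")
      case True
      then have "realisation ?L = trivial_topology"
        by (simp add: topspace_realisation realisation_points_def flip: null_topspace_iff_trivial)
      then show ?thesis
        by simp
    next
      case False
      show ?thesis
      proof (rule contractible_of_contractible_links[OF R ac False])
        fix u w assume uw: "u \<in> vertices ?L" "w \<in> vertices ?L" "(u, w) \<in> R"
        have "(w, v) \<in> R"
          using uw(2) unfolding vertices_def descending_link_def by blast
        then show "descending_link R ?L w \<noteq> {} \<and>
            contractible_space (realisation (descending_link R ?L w))"
          using less.IH[OF _ L] descending_link_nonempty[OF R L uw(2,1,3)] by blast
      qed
    qed
  qed
qed

text \<open>
  Breaking ties of the colouring by an arbitrary well-order of the vertices. Since the exchange
  condition asks for a strictly smaller colour, it survives the refinement, and the vertices of a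
  common colour can be added one at a time.
\<close>

lemma wellorder_refinement:
  fixes c :: "'v \<Rightarrow> 'w::wellorder"
  obtains R where "strict_well_order R" "\<And>u v. c u < c v \<Longrightarrow> (u, v) \<in> R"
proof -
  obtain s :: "'v rel" where s: "well_order_on UNIV s"
    using well_order_on by blast
  define R where "R = inv_image ({(x :: 'w, y). x < y} <*lex*> (s - Id)) (\<lambda>v. (c v, v))"
  have s': "wf (s - Id)" "trans s" "antisym s" "total s"
    using s unfolding well_order_on_def linear_order_on_def partial_order_on_def preorder_on_def
    by blast+
  have "trans (s - Id)"
    using s' by (simp add: trans_diff_Id)
  moreover have "trans {(x :: 'w, y). x < y}"
    by (auto simp: trans_def)
  ultimately have "trans R"
    unfolding R_def by (intro trans_inv_image trans_lex_prod)
  moreover have "wf R"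
    unfolding R_def using s'(1) by (intro wf_inv_image wf_lex_prod wf)
  moreover have "total R"
    using s'(4) by (auto simp: total_on_def R_def neq_iff)
  ultimately show ?thesis
    using that by (auto simp: strict_well_order_def R_def)
qed

lemma edge_dist_eq_2:
  assumes "u \<noteq> w" "\<not> adjacent X u w" "two_interval X u w \<noteq> {}"
  shows "edge_dist X u w = 2"
  unfolding edge_dist_def
proof (rule Least_equality)
  obtain x where "adjacent X u x" "adjacent X x w"
    using assms(3) adjacent_sym[of X w] unfolding two_interval_def by blast
  then show "(adjacent X ^^ 2) u w"
    by (auto simp: numeral_2_eq_2)
  fix n assume n: "(adjacent X ^^ n) u w"
  have "n \<noteq> 0"
    using n assms(1) by (intro notI) simp
  moreover have "n \<noteq> 1"
    using n assms(2) by (metis relpowp_1)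
  ultimately show "2 \<le> n"
    by simp
qed

theorem theoremB:
  fixes X :: "'v set set" and c :: "'v \<Rightarrow> 'w::wellorder"
  assumes "X \<noteq> {}"
    and "flag_complex X"
    and "connected_complex X"
    and "exchange_complex X c"
  shows "contractible_space (realisation X)"
proof -
  obtain R where R: "strict_well_order R" and c: "\<And>u v. c u < c v \<Longrightarrow> (u, v) \<in> R"
    using wellorder_refinement[of c] by blast
  have "\<exists>x. is_apex X (two_interval X u w) x \<and> ((x, u) \<in> R \<or> (x, w) \<in> R)"
    if "u \<in> vertices X" "w \<in> vertices X" "u \<noteq> w" "\<not> adjacent X u w" "two_interval X u w \<noteq> {}" for u w
  proof -
    have "\<exists>x. is_apex X (two_interval X u w) x \<and> c x < max (c u) (c w)"
      using assms(4) that edge_dist_eq_2[of u w X] unfolding exchange_complex_def by blast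
    then show ?thesis
      using c by (auto simp: less_max_iff_disj)
  qed
  then have X: "exchange_order R X"
    using assms(2,3) unfolding exchange_order_def by blast
  have ac: "abstract_complex X"
    using assms(2) by (simp add: flag_complex_def)
  show ?thesis
    by (rule contractible_of_contractible_links[OF R ac assms(1)])
      (simp add: descending_link_nonempty[OF R X] contractible_descending_link[OF R X])
qed

end
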